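(* Let $\begin{pmatrix}u \\ v\end{pmatrix}\in\mathfrak{X}(\mathbb{O}^2)$ be a vector field with $u,v\in C^\infty(\mathbb{O}^2,\mathbb{O})$ linear in the coordinates $x^i$ and $y^i$. If $\begin{pmatrix}u \\ v\end{pmatrix}$ is tangent to the leaves of the singular octonionic Hopf leaf decomposition $\mathcal{L}_{OH}$, then $u=v\equiv0$.
   Context: $\mathbb{O}\cong\mathbb{R}^8$ denotes the octonions: the real unital non-associative algebra with orthonormal basis $e_0=1,e_1,\dots,e_7$ and $e_i\cdot e_j=-\delta_{ij}1+\sum_k\epsilon_{ijk}e_k$ for $1\le i,j\le 7$, where $\epsilon_{ijk}$ is completely antisymmetric, equal to $1$ for $ijk\in\{123,145,176,246,257,347,365\}$, and $0$ for all triples that are not permutations of these; $\|\cdot\|$ is the Euclidean norm. $\mathcal{L}_{OH}$: for $m\in\mathbb{O}$ let $l_m=\{(x,m\cdot x):x\in\mathbb{O}\}$ and let $l_\infty=\{(0,x):x\in\mathbb{O}\}$. For $r>0$ let $\mathrm{S}(r)=\{(x,y)\in\mathbb{O}^2:\|x\|^2+\|y\|^2=r^2\}$. The leaves of $\mathcal{L}_{OH}$ are $l_m\cap \mathrm{S}(r)$, $l_\infty\cap \mathrm{S}(r)$ ($m\in\mathbb{O}$, $r>0$), and the origin. A vector field is tangent to the leaves if at each point it lies in the tangent space of the leaf through that point. The pair $\begin{pmatrix}u \\ v\end{pmatrix}$ denotes the vector field $\sum_i\left(u^i\frac{\partial}{\partial x^i}+v^i\frac{\partial}{\partial y^i}\right)$,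 with $x^i,y^i,u^i,v^i$ ($i=0,\dots,7$) the components in the basis $e_i$. Linear means homogeneous of degree one, i.e. $u,v:\mathbb{O}^2\to\mathbb{O}$ are $\mathbb{R}$-linear maps. *)

theory Defs
  imports "HOL-Analysis.Analysis"
begin

text \<open>Octonions are modelled on \<open>real ^ 8\<close>; the elements \<open>0, 1, \<dots>, 7\<close> of the finite type \<open>8\<close> index
  the basis. Note that \<open>*\<close> on \<open>real ^ 8\<close> is the componentwise product of the library; the
  octonion product is \<open>\<cdot>\<close> below.\<close>

type_synonym octonion = "real ^ 8"

definition oct_basis :: "8 \<Rightarrow> octonion" where
  "oct_basis i = axis i 1"

definition oct_triples :: "(8 \<times> 8 \<times> 8) set" where
  "oct_triples = {(1,2,3), (1,4,5), (1,7,6), (2,4,6), (2,5,7), (3,4,7), (3,6,5)}"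

text \<open>The completely antisymmetric symbol: the first case collects the even, the second the odd
  permutations of the triples.\<close>

definition oct_eps :: "8 \<Rightarrow> 8 \<Rightarrow> 8 \<Rightarrow> real" where
  "oct_eps i j k =
    (if (i,j,k) \<in> oct_triples \<or> (j,k,i) \<in> oct_triples \<or> (k,i,j) \<in> oct_triples then 1
     else if (j,i,k) \<in> oct_triples \<or> (i,k,j) \<in> oct_triples \<or> (k,j,i) \<in> oct_triples then -1
     else 0)"

definition oct_basis_mult :: "8 \<Rightarrow> 8 \<Rightarrow> octonion" where
  "oct_basis_mult i j =
    (if i = 0 then oct_basis j
     else if j = 0 then oct_basis i
     else (if i = j then - oct_basis 0 else 0) + (\<Sum>k\<in>UNIV - {0}. oct_eps i j k *\<^sub>R oct_basis k))"

definition oct_mult :: "octonion \<Rightarrow> octonion \<Rightarrow> octonion" (infixl "\<cdot>" 70) where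
  "x \<cdot> y = (\<Sum>i\<in>UNIV. \<Sum>j\<in>UNIV. (x $ i * y $ j) *\<^sub>R oct_basis_mult i j)"

definition oct_line :: "octonion \<Rightarrow> (octonion \<times> octonion) set" where
  "oct_line m = {(x, m \<cdot> x) | x. True}"

definition oct_line_inf :: "(octonion \<times> octonion) set" where
  "oct_line_inf = {(0, x) | x. True}"

definition oct_sphere :: "real \<Rightarrow> (octonion \<times> octonion) set" where
  "oct_sphere r = {(x, y). (norm x)\<^sup>2 + (norm y)\<^sup>2 = r\<^sup>2}"

definition OH_leaves :: "(octonion \<times> octonion) set set" where
  "OH_leaves = {oct_line m \<inter> oct_sphere r | m r. r > 0}
     \<union> {oct_line_inf \<inter> oct_sphere r | r. r > 0} \<union> {{(0, 0)}}"

text \<open>\<open>D n\<close> is the \<open>n\<close>-th derivative of \<open>c\<close>.\<close>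

definition smooth_curve_on :: "real set \<Rightarrow> (real \<Rightarrow> 'a::real_normed_vector) \<Rightarrow> bool" where
  "smooth_curve_on I c \<longleftrightarrow>
    (\<exists>D. D 0 = c \<and> (\<forall>n. \<forall>t\<in>I. (D n has_vector_derivative D (Suc n) t) (at t)))"

text \<open>Tangent space at \<open>p\<close> of an embedded submanifold \<open>L\<close>: the velocities at \<open>p\<close> of smooth curves
  running in \<open>L\<close>. Tangent vectors of the ambient vector space are identified with its elements.\<close>

definition tangent_space :: "'a::real_normed_vector set \<Rightarrow> 'a \<Rightarrow> 'a set" where
  "tangent_space L p =
    {w. \<exists>c \<epsilon>. \<epsilon> > 0 \<and> smooth_curve_on {-\<epsilon><..<\<epsilon>} c \<and> c ` {-\<epsilon><..<\<epsilon>} \<subseteq> L \<and> c 0 = p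
          \<and> (c has_vector_derivative w) (at 0)}"

definition tangent_to_leaves :: "('a::real_normed_vector \<Rightarrow> 'a) \<Rightarrow> 'a set set \<Rightarrow> bool" where
  "tangent_to_leaves V \<L> \<longleftrightarrow> (\<forall>L\<in>\<L>. \<forall>p\<in>L. V p \<in> tangent_space L p)"

end

theory Submission imports Defs begin

text \<open>Tangency to \<open>l\<^sub>m\<close> means \<open>v (x, m \<cdot> x) = m \<cdot> u (x, m \<cdot> x)\<close> and tangency to \<open>l\<^sub>\<infinity>\<close> means
  \<open>u (0, y) = 0\<close>. For linear fields this leaves \<open>u (x, y) = x \<cdot> a\<close> and \<open>v (x, y) = y \<cdot> a\<close> with
  \<open>a = u (1, 0)\<close>, where \<open>(m \<cdot> x) \<cdot> a = m \<cdot> (x \<cdot> a)\<close> for all \<open>m\<close> and \<open>x\<close>. Hence \<open>a\<close> lies in the nucleus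
  of the octonions and is real. Tangency to the spheres makes \<open>a\<close> orthogonal to \<open>1\<close>, so \<open>a = 0\<close>.\<close>

text \<open>Induction on the finite type represents an element by an integer \<open>z\<close> with 0
  \<le> \<open>z\<close> < 8, which leaves eight cases.\<close>

lemma exhaust_8:
  fixes x :: 8
  shows "x = 0 \<or> x = 1 \<or> x = 2 \<or> x = 3 \<or> x = 4 \<or> x = 5 \<or> x = 6 \<or> x = 7"
proof (induct x)
  case (of_int z)
  then have "z = 0 \<or> z = 1 \<or> z = 2 \<or> z = 3 \<or> z = 4 \<or> z = 5 \<or> z = 6 \<or> z = 7"
    by simp arith
  then show ?case by auto
qed

lemma forall_8:
  "(\<forall>i::8. P i) \<longleftrightarrow> P 0 \<and> P 1 \<and> P 2 \<and> P 3 \<and> P 4 \<and> P 5 \<and> P 6 \<and> P 7"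
  by (metis exhaust_8)

lemma UNIV_8: "(UNIV :: 8 set) = {0, 1, 2, 3, 4, 5, 6, 7}"
  using exhaust_8 by auto

lemma sum_8:
  fixes f :: "8 \<Rightarrow> 'a::comm_monoid_add"
  shows "sum f UNIV = f 0 + f 1 + f 2 + f 3 + f 4 + f 5 + f 6 + f 7"
  unfolding UNIV_8 by (simp add: ac_simps)

lemma oct_basis_nth: "oct_basis i $ k = (if k = i then 1 else 0)"
  by (simp add: oct_basis_def axis_def)

lemma sum_oct_basis_nth:
  "(\<Sum>i\<in>S. f i * oct_basis i $ k) = (if k \<in> S then f k else 0)"
proof -
  have "(\<Sum>i\<in>S. f i * oct_basis i $ k) = (\<Sum>i\<in>S. if k = i then f i else 0)"
    by (rule sum.cong) (simp_all add: oct_basis_nth)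
  then show ?thesis by simp
qed

lemma oct_basis_mult_nth:
  "oct_basis_mult i j $ k =
    (if i = 0 then oct_basis j $ k else if j = 0 then oct_basis i $ k
     else if k = 0 then (if i = j then -1 else 0) else oct_eps i j k)"
  by (auto simp: oct_basis_mult_def sum_oct_basis_nth) (simp_all add: oct_basis_nth)

lemma linear_oct_mult_right: "linear (\<lambda>y. x \<cdot> y)"
  by (rule linearI)
    (simp_all add: oct_mult_def algebra_simps scaleR_sum_right sum.distrib)

lemma oct_basis_left: "oct_basis i \<cdot> y = (\<Sum>j\<in>UNIV. y $ j *\<^sub>R oct_basis_mult i j)"
proof -
  have "oct_basis i \<cdot> y =
      (\<Sum>i'\<in>UNIV. if i' = i then \<Sum>j\<in>UNIV. y $ j *\<^sub>R oct_basis_mult i' j else 0)"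
    unfolding oct_mult_def oct_basis_nth by (rule sum.cong) simp_all
  then show ?thesis by simp
qed

lemma oct_basis_right: "x \<cdot> oct_basis j = (\<Sum>i\<in>UNIV. x $ i *\<^sub>R oct_basis_mult i j)"
proof -
  have "(\<Sum>j'\<in>UNIV. (x $ i * oct_basis j $ j') *\<^sub>R oct_basis_mult i j') = x $ i *\<^sub>R oct_basis_mult i j" for i
  proof -
    have "(\<Sum>j'\<in>UNIV. (x $ i * oct_basis j $ j') *\<^sub>R oct_basis_mult i j') =
        (\<Sum>j'\<in>UNIV. if j' = j then x $ i *\<^sub>R oct_basis_mult i j' else 0)"
      unfolding oct_basis_nth by (rule sum.cong) simp_all
    then show ?thesis by simp
  qed
  then show ?thesis unfolding oct_mult_def by simp
qed

lemma oct_basis_expansion: "(\<Sum>i\<in>UNIV. x $ i *\<^sub>R oct_basis i) = x"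
  by (simp add: vec_eq_iff sum_oct_basis_nth)

lemma oct_one_left: "oct_basis 0 \<cdot> x = x"
  by (simp add: oct_basis_left oct_basis_mult_def oct_basis_expansion)

lemma oct_one_right: "x \<cdot> oct_basis 0 = x"
proof -
  have "oct_basis_mult i 0 = oct_basis i" for i
    by (simp add: oct_basis_mult_def)
  then show ?thesis
    by (simp add: oct_basis_right oct_basis_expansion)
qed

lemma oct_zero_left: "0 \<cdot> x = 0"
  by (simp add: oct_mult_def)

lemma oct_zero_right: "x \<cdot> 0 = 0"
  by (simp add: oct_mult_def)

text \<open>The multiplication table in coordinates: left multiplication by an imaginary unit is a
  signed permutation of the coordinates. Tabulated are the units that enter the associators in
  \<open>oct_nucleus_real\<close>.\<close>

lemma oct_basis_left_nth:
  "(oct_basis 1 \<cdot> y) $ 0 = - y $ 1" "(oct_basis 1 \<cdot> y) $ 1 = y $ 0" "(oct_basis 1 \<cdot> y) $ 2 = - y $ 3" "(oct_basis 1 \<cdot> y) $ 3 = y $ 2"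
  "(oct_basis 1 \<cdot> y) $ 4 = - y $ 5" "(oct_basis 1 \<cdot> y) $ 5 = y $ 4" "(oct_basis 1 \<cdot> y) $ 6 = y $ 7" "(oct_basis 1 \<cdot> y) $ 7 = - y $ 6"
  "(oct_basis 2 \<cdot> y) $ 0 = - y $ 2" "(oct_basis 2 \<cdot> y) $ 1 = y $ 3" "(oct_basis 2 \<cdot> y) $ 2 = y $ 0" "(oct_basis 2 \<cdot> y) $ 3 = - y $ 1"
  "(oct_basis 2 \<cdot> y) $ 4 = - y $ 6" "(oct_basis 2 \<cdot> y) $ 5 = - y $ 7" "(oct_basis 2 \<cdot> y) $ 6 = y $ 4" "(oct_basis 2 \<cdot> y) $ 7 = y $ 5"
  "(oct_basis 3 \<cdot> y) $ 0 = - y $ 3" "(oct_basis 3 \<cdot> y) $ 1 = - y $ 2" "(oct_basis 3 \<cdot> y) $ 2 = y $ 1" "(oct_basis 3 \<cdot> y) $ 3 = y $ 0"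
  "(oct_basis 3 \<cdot> y) $ 4 = - y $ 7" "(oct_basis 3 \<cdot> y) $ 5 = y $ 6" "(oct_basis 3 \<cdot> y) $ 6 = - y $ 5" "(oct_basis 3 \<cdot> y) $ 7 = y $ 4"
  "(oct_basis 4 \<cdot> y) $ 0 = - y $ 4" "(oct_basis 4 \<cdot> y) $ 1 = y $ 5" "(oct_basis 4 \<cdot> y) $ 2 = y $ 6" "(oct_basis 4 \<cdot> y) $ 3 = y $ 7"
  "(oct_basis 4 \<cdot> y) $ 4 = y $ 0" "(oct_basis 4 \<cdot> y) $ 5 = - y $ 1" "(oct_basis 4 \<cdot> y) $ 6 = - y $ 2" "(oct_basis 4 \<cdot> y) $ 7 = - y $ 3"
  "(oct_basis 5 \<cdot> y) $ 0 = - y $ 5" "(oct_basis 5 \<cdot> y) $ 1 = - y $ 4" "(oct_basis 5 \<cdot> y) $ 2 = y $ 7" "(oct_basis 5 \<cdot> y) $ 3 = - y $ 6"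
  "(oct_basis 5 \<cdot> y) $ 4 = y $ 1" "(oct_basis 5 \<cdot> y) $ 5 = y $ 0" "(oct_basis 5 \<cdot> y) $ 6 = y $ 3" "(oct_basis 5 \<cdot> y) $ 7 = - y $ 2"
  "(oct_basis 6 \<cdot> y) $ 0 = - y $ 6" "(oct_basis 6 \<cdot> y) $ 1 = - y $ 7" "(oct_basis 6 \<cdot> y) $ 2 = - y $ 4" "(oct_basis 6 \<cdot> y) $ 3 = y $ 5"
  "(oct_basis 6 \<cdot> y) $ 4 = y $ 2" "(oct_basis 6 \<cdot> y) $ 5 = - y $ 3" "(oct_basis 6 \<cdot> y) $ 6 = y $ 0" "(oct_basis 6 \<cdot> y) $ 7 = y $ 1"
  by (simp_all add: oct_basis_left sum_8 oct_basis_mult_nth oct_basis_nth oct_eps_def oct_triples_def)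

text \<open>Three associators suffice. Two distinct imaginary units associate with \<open>a\<close>
  only if \<open>a\<close> lies in the quaternion subalgebra they generate. The pairs (1,2), (1,4),
  (2,4) give the subalgebras with imaginary indices 123, 145, 246, and no index lies in all
  three.\<close>

lemma oct_nucleus_real:
  assumes "\<And>x y. (x \<cdot> y) \<cdot> a = x \<cdot> (y \<cdot> a)"
  shows "a = a $ 0 *\<^sub>R oct_basis 0"
proof -
  have "oct_basis 1 \<cdot> oct_basis 2 = oct_basis 3" "oct_basis 1 \<cdot> oct_basis 4 = oct_basis 5"
    "oct_basis 2 \<cdot> oct_basis 4 = oct_basis 6"
    by (simp_all add: vec_eq_iff forall_8 oct_basis_left_nth oct_basis_nth)
  then have "oct_basis 3 \<cdot> a = oct_basis 1 \<cdot> (oct_basis 2 \<cdot> a)"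
    "oct_basis 5 \<cdot> a = oct_basis 1 \<cdot> (oct_basis 4 \<cdot> a)"
    "oct_basis 6 \<cdot> a = oct_basis 2 \<cdot> (oct_basis 4 \<cdot> a)"
    using assms by metis+
  then have "a $ 1 = 0" "a $ 2 = 0" "a $ 3 = 0" "a $ 4 = 0" "a $ 5 = 0" "a $ 6 = 0" "a $ 7 = 0"
    by (simp_all add: vec_eq_iff forall_8 oct_basis_left_nth)
  then show ?thesis
    by (simp add: vec_eq_iff forall_8 oct_basis_nth)
qed

text \<open>Along a curve in \<open>L\<close> the function \<open>f\<close> is constantly zero,
  while by linearity its derivative at time 0 is \<open>f w\<close>. Applied below to linear maps
  whose kernels are the planes \<open>oct_line m\<close> and \<open>oct_line_inf\<close>.\<close>

lemma tangent_space_linear_constraint: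
  assumes "w \<in> tangent_space L p" and "bounded_linear f" and "\<And>q. q \<in> L \<Longrightarrow> f q = 0"
  shows "f w = 0"
proof -
  obtain c \<epsilon> where c: "\<epsilon> > 0" "\<And>t. t \<in> {-\<epsilon><..<\<epsilon>} \<Longrightarrow> c t \<in> L" "(c has_vector_derivative w) (at 0)"
    using assms(1) unfolding tangent_space_def image_subset_iff by blast
  have "((\<lambda>t. f (c t)) has_vector_derivative f w) (at 0)"
    using bounded_linear.has_vector_derivative[OF assms(2) c(3)] .
  then have "((\<lambda>t. 0) has_vector_derivative f w) (at 0)"
    using c(1,2) assms(3)
    by (elim has_vector_derivative_transform_within_open[where S = "{-\<epsilon><..<\<epsilon>}"]) auto
  then show ?thesis
    by (metis has_vector_derivative_const vector_derivative_unique_at)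
qed

text \<open>Differentiating the constant \<open>c t \<bullet> c t\<close> by the product rule gives
  twice \<open>p \<bullet> w\<close>.\<close>

lemma tangent_space_sphere_orthogonal:
  fixes p :: "'a::real_inner"
  assumes "w \<in> tangent_space L p" and "\<And>q. q \<in> L \<Longrightarrow> q \<bullet> q = s"
  shows "p \<bullet> w = 0"
proof -
  obtain c \<epsilon> where c: "\<epsilon> > 0" "\<And>t. t \<in> {-\<epsilon><..<\<epsilon>} \<Longrightarrow> c t \<in> L" "c 0 = p" "(c has_vector_derivative w) (at 0)"
    using assms(1) unfolding tangent_space_def image_subset_iff by blast
  have "((\<lambda>t. c t \<bullet> c t) has_vector_derivative p \<bullet> w + w \<bullet> p) (at 0)"
    using bounded_bilinear.has_vector_derivative[OF bounded_bilinear_inner c(4) c(4)] c(3) by simp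
  then have "((\<lambda>t. s) has_vector_derivative p \<bullet> w + w \<bullet> p) (at 0)"
    using c(1,2) assms(2)
    by (elim has_vector_derivative_transform_within_open[where S = "{-\<epsilon><..<\<epsilon>}"]) auto
  then have "p \<bullet> w + w \<bullet> p = 0"
    by (metis has_vector_derivative_const vector_derivative_unique_at)
  then show ?thesis
    by (simp add: inner_commute)
qed

lemma mem_oct_sphere_iff: "q \<in> oct_sphere r \<longleftrightarrow> q \<bullet> q = r\<^sup>2"
  by (cases q) (simp add: oct_sphere_def power2_norm_eq_inner)

text \<open>The leaf through the point has the norm of the point as radius;
  \<open>x \<noteq> 0\<close> makes it positive, as \<open>OH_leaves\<close> demands.\<close>

lemma tangent_at_oct_line:
  assumes "tangent_to_leaves V OH_leaves" and "x \<noteq> 0"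
  shows "V (x, m \<cdot> x) \<in> tangent_space (oct_line m \<inter> oct_sphere (norm (x, m \<cdot> x))) (x, m \<cdot> x)"
proof -
  have "oct_line m \<inter> oct_sphere (norm (x, m \<cdot> x)) \<in> OH_leaves"
  proof -
    have "norm (x, m \<cdot> x) > 0"
      using assms(2) by (simp add: zero_prod_def)
    then show ?thesis
      unfolding OH_leaves_def by blast
  qed
  moreover have "(x, m \<cdot> x) \<in> oct_line m \<inter> oct_sphere (norm (x, m \<cdot> x))"
    by (auto simp: oct_line_def mem_oct_sphere_iff power2_norm_eq_inner)
  ultimately show ?thesis
    using assms(1) unfolding tangent_to_leaves_def by blast
qed

lemma tangent_at_oct_line_inf:
  assumes "tangent_to_leaves V OH_leaves" and "y \<noteq> 0"
  shows "V (0, y) \<in> tangent_space (oct_line_inf \<inter> oct_sphere (norm y)) (0, y)"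
proof -
  have "oct_line_inf \<inter> oct_sphere (norm y) \<in> OH_leaves"
  proof -
    have "norm y > 0"
      using assms(2) by simp
    then show ?thesis
      unfolding OH_leaves_def by blast
  qed
  moreover have "(0, y) \<in> oct_line_inf \<inter> oct_sphere (norm y)"
    by (auto simp: oct_line_inf_def oct_sphere_def)
  ultimately show ?thesis
    using assms(1) unfolding tangent_to_leaves_def by blast
qed

theorem lemma4p19:
  fixes u v :: "octonion \<times> octonion \<Rightarrow> octonion"
  assumes "linear u" and "linear v"
    and "tangent_to_leaves (\<lambda>p. (u p, v p)) OH_leaves"
  shows "u = (\<lambda>p. 0) \<and> v = (\<lambda>p. 0)"
proof -
  have zero: "u (0, 0) = 0" "v (0, 0) = 0"
    using linear_0[OF assms(1)] linear_0[OF assms(2)] by (simp_all add: zero_prod_def)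
  have on_line: "v (x, m \<cdot> x) = m \<cdot> u (x, m \<cdot> x)" for m x
  proof (cases "x = 0")
    case True
    then show ?thesis by (simp add: zero oct_zero_right)
  next
    case False
    \<comment> \<open>The kernel of this map is \<open>oct_line m\<close>, so its vanishing on the
      field is the claimed relation.\<close>
    have "bounded_linear (\<lambda>q :: octonion \<times> octonion. snd q - m \<cdot> fst q)"
      by (intro bounded_linear_sub bounded_linear_snd bounded_linear_compose[OF _ bounded_linear_fst])
        (rule linear_conv_bounded_linear[THEN iffD1, OF linear_oct_mult_right])
    from tangent_space_linear_constraint[OF tangent_at_oct_line[OF assms(3) False, of m] this]
    show ?thesis by (auto simp: oct_line_def)
  qed
  have on_line_inf: "u (0, y) = 0" for y
  proof (cases "y = 0")
    case True
    then show ?thesis by (simp add: zero)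
  next
    case False
    from tangent_space_linear_constraint[OF tangent_at_oct_line_inf[OF assms(3) False] bounded_linear_fst]
    show ?thesis by (auto simp: oct_line_inf_def)
  qed
  have u_eq: "u (x, y) = u (x, 0)" for x y
    using linear_add[OF assms(1), of "(x, 0)" "(0, y)"] on_line_inf[of y] by simp
  \<comment> \<open>The case \<open>m = 0\<close>, where the line is the first coordinate
    plane.\<close>
  have "v (x, 0) = 0" for x
    using on_line[of x 0] by (simp add: oct_zero_left)
  then have v_eq: "v (x, y) = v (0, y)" for x y
    using linear_add[OF assms(2), of "(x, 0)" "(0, y)"] by simp
  define a where "a = u (oct_basis 0, 0)"
  \<comment> \<open>All tangency to the lines \<open>oct_line m\<close> is now one identity between
    the two restrictions \<open>v (0, _)\<close> and \<open>u (_, 0)\<close>. Putting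
    \<open>x = 1\<close> and then \<open>m = 1\<close> shows that both are right multiplication by
    \<open>a\<close>.\<close>
  have intertwine: "v (0, m \<cdot> x) = m \<cdot> u (x, 0)" for m x
    using on_line[of x m] u_eq[of x "m \<cdot> x"] v_eq[of x "m \<cdot> x"] by simp
  have v_a: "v (0, y) = y \<cdot> a" for y
    using intertwine[of y "oct_basis 0"] by (simp add: oct_one_right a_def)
  have u_a: "u (x, 0) = x \<cdot> a" for x
    using intertwine[of "oct_basis 0" x] by (simp add: oct_one_left v_a)
  \<comment> \<open>With both restrictions known, \<open>intertwine\<close> reads
    \<open>(m \<cdot> x) \<cdot> a = m \<cdot> (x \<cdot> a)\<close>.\<close>
  have "a = a $ 0 *\<^sub>R oct_basis 0"
    using intertwine by (intro oct_nucleus_real) (simp add: v_a u_a)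
  moreover have "a $ 0 = 0"
  proof -
    have "oct_basis 0 \<noteq> 0"
      by (simp add: oct_basis_def axis_eq_0_iff)
    \<comment> \<open>At the point (1, 0) of \<open>oct_line 0\<close> the field has first component
      \<open>a\<close>, and its second is paired with 0, so orthogonality to the point isolates the
      real part of \<open>a\<close>.\<close>
    from tangent_space_sphere_orthogonal[OF tangent_at_oct_line[OF assms(3) this, of 0]]
    have "(oct_basis 0, 0) \<bullet> (a, v (oct_basis 0, 0)) = 0"
      by (simp add: oct_zero_left mem_oct_sphere_iff a_def)
    then show ?thesis
      by (simp add: oct_basis_def inner_axis')
  qed
  ultimately have "a = 0" by simp
  then show ?thesis
    using u_eq v_eq by (auto simp: u_a v_a oct_zero_right)
qed

end
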